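(* Let $n\ge 3$. Every combinatorial $(n,2)$-hypersimplex is (up to affine isomorphism) a facet of a combinatorial $(n+1,2)$-hypersimplex.
   Context: For integers $0<k<n$, $\Delta_{n,k}=\mathrm{conv}\{x\in\{0,1\}^n : x_1+\cdots+x_n=k\}$. A combinatorial $(n,k)$-hypersimplex is any polytope whose face lattice is isomorphic to the face lattice of $\Delta_{n,k}$. *)

theory Defs
  imports "HOL-Analysis.Analysis" "HOL-Analysis.Finite_Function_Topology"
begin

text \<open>
  The index \<open>n\<close> has to be a term, since \<open>n\<close> and \<open>n + 1\<close> both occur in one statement. We therefore
  realise \<open>\<real>\<^sup>n\<close> as the subspace of the finitely supported functions \<^typ>\<open>nat \<Rightarrow>\<^sub>0 real\<close>
  whose support lies in \<open>{..<n}\<close> (so coordinates are numbered from 0).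
\<close>

definition hypersimplex :: "nat \<Rightarrow> nat \<Rightarrow> (nat \<Rightarrow>\<^sub>0 real) set" where
  "hypersimplex n k =
     convex hull {x. Poly_Mapping.keys x \<subseteq> {..<n} \<and>
                     (\<forall>i<n. Poly_Mapping.lookup x i \<in> {0, 1}) \<and>
                     (\<Sum>i<n. Poly_Mapping.lookup x i) = real k}"

text \<open>
  Faces include the empty face and the polytope itself. An order isomorphism of lattices is the same
  as a lattice isomorphism.
\<close>

definition face_lattice_isomorphic :: "'a::real_vector set \<Rightarrow> 'b::real_vector set \<Rightarrow> bool" where
  "face_lattice_isomorphic P Q \<longleftrightarrow>
     (\<exists>\<phi>. bij_betw \<phi> {F. F face_of P} {G. G face_of Q} \<and>
          (\<forall>F F'. F face_of P \<longrightarrow> F' face_of P \<longrightarrow> (F \<subseteq> F' \<longleftrightarrow> \<phi> F \<subseteq> \<phi> F')))"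

definition combinatorial_hypersimplex :: "nat \<Rightarrow> nat \<Rightarrow> 'a::real_vector set \<Rightarrow> bool" where
  "combinatorial_hypersimplex n k P \<longleftrightarrow>
     0 < k \<and> k < n \<and> polytope P \<and> face_lattice_isomorphic P (hypersimplex n k)"

text \<open>
  Every affine bijection between the affine hulls extends to an affine map \<open>x \<mapsto> c + f x\<close> of the
  ambient spaces, which need not have the same dimension.
\<close>

definition affinely_isomorphic :: "'a::real_vector set \<Rightarrow> 'b::real_vector set \<Rightarrow> bool" where
  "affinely_isomorphic S T \<longleftrightarrow>
     (\<exists>f c. linear f \<and> inj_on (\<lambda>x. c + f x) (affine hull S) \<and> (\<lambda>x. c + f x) ` S = T)"

end

theory Submission
  imports Defs
begin

text \<open>
  A combinatorial \<open>(n,2)\<close>-hypersimplex has vertices \<open>p\<^sub>i\<^sub>j\<close> indexed by the edges of the complete graph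
  on \<open>n\<close> nodes. Its homogenization has a basis \<open>v\<^sub>0, \<dots>, v\<^sub>n\<^sub>-\<^sub>1\<close> in which \<open>(p\<^sub>i\<^sub>j, 1)\<close> is a positive
  combination of \<open>v\<^sub>i\<close> and \<open>v\<^sub>j\<close>. Conversely, any such choice of points gives a combinatorial
  hypersimplex: the vertex sets of its faces are the cliques and the subsets of stars, whatever the
  positive coefficients are. So one adjoins a new basis vector \<open>v\<^sub>n\<close> of height 1 and, for a small
  \<open>t > 0\<close>, the points in the directions \<open>t v\<^sub>i + v\<^sub>n\<close>. Some \<open>v\<^sub>i\<close> may have height \<open>\<le> 0\<close>, and
  \<open>t\<close> is chosen so that all new directions have positive height.
\<close>

section \<open>Vertex sets of faces\<close>

text \<open>Faces are recorded by the labels of the points on them, so that polytopes in different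
  spaces with the same label set can be compared.\<close>

definition facial :: "('i \<Rightarrow> 'a::real_vector) \<Rightarrow> 'i set \<Rightarrow> 'i set \<Rightarrow> bool" where
  "facial p E S \<longleftrightarrow> (\<exists>F. F face_of (convex hull (p ` E)) \<and> S = {e \<in> E. p e \<in> F})"

text \<open>Write \<open>x \<in> F\<close> as a convex combination of \<open>V\<close>. Any
  \<open>v\<close> of positive weight either equals \<open>x\<close> or is an endpoint of an open
  segment through \<open>x\<close> whose other end is the normalized rest of the combination, so it
  lies in \<open>F\<close>. Thus only points of \<open>F \<inter> V\<close> are used.\<close>

lemma face_of_finite_hull:
  fixes V :: "'a::real_vector set"
  assumes "finite V" and F: "F face_of (convex hull V)"
  shows "F = convex hull (F \<inter> V)"
proof
  show "convex hull (F \<inter> V) \<subseteq> F"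
    using F by (simp add: face_of_imp_convex hull_minimal)
  show "F \<subseteq> convex hull (F \<inter> V)"
  proof
    fix x assume x: "x \<in> F"
    then have "x \<in> convex hull V"
      using F face_of_imp_subset by blast
    then obtain w where w: "\<forall>v\<in>V. 0 \<le> w v" "sum w V = 1" "(\<Sum>v\<in>V. w v *\<^sub>R v) = x"
      using convex_hull_finite[OF \<open>finite V\<close>] by auto
    have pos: "v \<in> F" if v: "v \<in> V" "w v > 0" for v
    proof -
      have s1: "w v + sum w (V - {v}) = 1"
        using w(2) sum.remove[OF \<open>finite V\<close> v(1), of w] by simp
      have xv: "x = w v *\<^sub>R v + (\<Sum>u\<in>V-{v}. w u *\<^sub>R u)"
        using w(3) sum.remove[OF \<open>finite V\<close> v(1), of "\<lambda>v. w v *\<^sub>R v"] by simp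
      have nn: "sum w (V - {v}) \<ge> 0"
        using w(1) by (intro sum_nonneg) auto
      show ?thesis
      proof (cases "sum w (V - {v}) = 0")
        case True
        then have "\<forall>u\<in>V-{v}. w u = 0"
          using w(1) sum_nonneg_eq_0_iff[of "V - {v}" w] \<open>finite V\<close> by auto
        then have "x = v"
          using xv s1 True by simp
        then show ?thesis using x by simp
      next
        case False
        define s where "s = sum w (V - {v})"
        have s: "s > 0" using False nn s_def by simp
        define y where "y = (\<Sum>u\<in>V-{v}. (w u / s) *\<^sub>R u)"
        have yV: "y \<in> convex hull V"
          unfolding y_def
          by (rule convex_sum) (use \<open>finite V\<close> w(1) s in
              \<open>auto simp: sum_divide_distrib[symmetric] s_def hull_inc\<close>)
        have sy: "s *\<^sub>R y = (\<Sum>u\<in>V-{v}. w u *\<^sub>R u)"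
          unfolding y_def scaleR_right.sum using s by simp
        have xs: "x = (1 - s) *\<^sub>R v + s *\<^sub>R y"
          using xv sy s1 by (simp add: s_def eq_diff_eq)
        show ?thesis
        proof (cases "v = y")
          case True
          then have "x = v" using xs by (simp add: scaleR_left_diff_distrib)
          then show ?thesis using x by simp
        next
          case False
          have "x \<in> open_segment v y"
            unfolding in_segment using False xs s s1 v(2) s_def by (intro conjI exI[of _ s]) auto
          then show ?thesis
            using F x yV v(1) by (meson face_ofD hull_inc)
        qed
      qed
    qed
    have "x = (\<Sum>v\<in>F \<inter> V. w v *\<^sub>R v)"
      unfolding w(3)[symmetric]
      by (rule sum.mono_neutral_right) (use \<open>finite V\<close> w(1) pos in \<open>auto simp: less_le\<close>)
    moreover have "sum w (F \<inter> V) = 1"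
      unfolding w(2)[symmetric]
      by (rule sum.mono_neutral_left) (use \<open>finite V\<close> w(1) pos in \<open>auto simp: less_le\<close>)
    ultimately show "x \<in> convex hull (F \<inter> V)"
      using \<open>finite V\<close> w(1) convex_sum[of "F \<inter> V" "convex hull (F \<inter> V)" w id]
      by (auto simp: hull_inc)
  qed
qed

lemma face_of_eq_hull_image:
  fixes p :: "'i \<Rightarrow> 'a::real_vector"
  assumes "finite E" and "F face_of (convex hull (p ` E))"
  shows "F = convex hull (p ` {e \<in> E. p e \<in> F})"
proof -
  have "F \<inter> p ` E = p ` {e \<in> E. p e \<in> F}" by auto
  then show ?thesis
    using face_of_finite_hull[OF _ assms(2)] assms(1) by simp
qed

lemma face_eq_hull_of_facial:
  fixes p :: "'i \<Rightarrow> 'a::real_vector"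
  assumes "finite E" and "facial p E S"
  shows "convex hull (p ` S) face_of (convex hull (p ` E))" "S = {e \<in> E. p e \<in> convex hull (p ` S)}"
proof -
  obtain F where F: "F face_of (convex hull (p ` E))" "S = {e \<in> E. p e \<in> F}"
    using assms(2) unfolding facial_def by blast
  then have "F = convex hull (p ` S)"
    using face_of_eq_hull_image[OF assms(1) F(1)] by simp
  then show "convex hull (p ` S) face_of (convex hull (p ` E))"
      "S = {e \<in> E. p e \<in> convex hull (p ` S)}"
    using F by simp_all
qed

lemma face_of_subset_iff:
  fixes p :: "'i \<Rightarrow> 'a::real_vector"
  assumes "finite E" and "F face_of (convex hull (p ` E))" and "G face_of (convex hull (p ` E))"
  shows "F \<subseteq> G \<longleftrightarrow> {e \<in> E. p e \<in> F} \<subseteq> {e \<in> E. p e \<in> G}"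
proof
  assume "{e \<in> E. p e \<in> F} \<subseteq> {e \<in> E. p e \<in> G}"
  then have "convex hull (p ` {e \<in> E. p e \<in> F}) \<subseteq> convex hull (p ` {e \<in> E. p e \<in> G})"
    by (intro hull_mono image_mono)
  then show "F \<subseteq> G"
    using face_of_eq_hull_image[OF assms(1,2)] face_of_eq_hull_image[OF assms(1,3)] by simp
qed auto

text \<open>By \<open>face_of_eq_hull_image\<close> a face is the hull of its labelled points.
  Keeping the label set and exchanging \<open>p\<close> for \<open>q\<close> therefore gives
  mutually inverse monotone maps.\<close>

lemma face_lattice_isomorphicI:
  fixes p :: "'i \<Rightarrow> 'a::real_vector" and q :: "'i \<Rightarrow> 'b::real_vector"
  assumes E: "finite E" and eq: "\<And>S. facial p E S \<longleftrightarrow> facial q E S"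
  shows "face_lattice_isomorphic (convex hull (p ` E)) (convex hull (q ` E))"
proof -
  let ?P = "convex hull (p ` E)" and ?Q = "convex hull (q ` E)"
  define f where "f F = convex hull (q ` {e \<in> E. p e \<in> F})" for F
  define g where "g F = convex hull (p ` {e \<in> E. q e \<in> F})" for F
  have f: "f F face_of ?Q" "{e \<in> E. q e \<in> f F} = {e \<in> E. p e \<in> F}" if "F face_of ?P" for F
    using face_eq_hull_of_facial[OF E, of q "{e \<in> E. p e \<in> F}"] that eq
    unfolding f_def facial_def by blast+
  have g: "g F face_of ?P" "{e \<in> E. p e \<in> g F} = {e \<in> E. q e \<in> F}" if "F face_of ?Q" for F
    using face_eq_hull_of_facial[OF E, of p "{e \<in> E. q e \<in> F}"] that eq
    unfolding g_def facial_def by blast+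
  have gf: "g (f F) = F" if "F face_of ?P" for F
    using face_of_eq_hull_image[OF E that] f(2)[OF that] by (simp add: g_def)
  have fg: "f (g F) = F" if "F face_of ?Q" for F
    using face_of_eq_hull_image[OF E that] g(2)[OF that] by (simp add: f_def)
  have "bij_betw f {F. F face_of ?P} {G. G face_of ?Q}"
    by (rule bij_betwI[of _ _ _ g]) (use f(1) g(1) gf fg in auto)
  moreover have "F \<subseteq> F' \<longleftrightarrow> f F \<subseteq> f F'" if "F face_of ?P" "F' face_of ?P" for F F'
    using face_of_subset_iff[OF E that] face_of_subset_iff[OF E f(1)[OF that(1)] f(1)[OF that(2)]]
      f(2) that by simp
  ultimately show ?thesis
    unfolding face_lattice_isomorphic_def by blast
qed

text \<open>The vertices of \<open>P\<close> correspond to those of the hull because they are the atoms of the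
  face lattices.\<close>
lemma face_lattice_isomorphicE:
  fixes P :: "'a::euclidean_space set" and q :: "'i \<Rightarrow> 'b::real_vector"
  assumes E: "finite E" and "polytope P"
    and iso: "face_lattice_isomorphic P (convex hull (q ` E))"
    and vert: "\<And>e. e \<in> E \<Longrightarrow> {q e} face_of (convex hull (q ` E))"
  obtains p where "P = convex hull (p ` E)" "\<And>S. facial q E S \<Longrightarrow> facial p E S"
    "\<And>S. facial p E S \<Longrightarrow> facial q E S"
proof -
  let ?Q = "convex hull (q ` E)"
  obtain f where bij: "bij_betw f {F. F face_of P} {G. G face_of ?Q}"
    and ord: "\<And>F F'. F face_of P \<Longrightarrow> F' face_of P \<Longrightarrow> F \<subseteq> F' \<longleftrightarrow> f F \<subseteq> f F'"
    using iso unfolding face_lattice_isomorphic_def by blast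
  have fface: "f F face_of ?Q" if "F face_of P" for F
    using bij that bij_betwE by fastforce
  have surj: "\<exists>F. F face_of P \<and> f F = G" if "G face_of ?Q" for G
    using bij that unfolding bij_betw_def by (metis (no_types, lifting) imageE mem_Collect_eq)
  have inj: "F = F'" if "F face_of P" "F' face_of P" "f F = f F'" for F F'
    using ord that by blast
  have f0: "f {} = {}"
    using surj[of "{}"] ord[of "{}"] by (metis empty_face_of empty_subsetI subset_empty)
  have ne: "\<exists>e\<in>E. q e \<in> G" if "G face_of ?Q" "G \<noteq> {}" for G
    using face_of_eq_hull_image[OF E that(1)] that(2)
    by (metis (mono_tags, lifting) convex_hull_empty empty_Collect_eq image_empty)
  have single: "\<exists>x. {x} face_of P \<and> f {x} = {q e}" if e: "e \<in> E" for e
  proof -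
    \<comment> \<open>An extreme point \<open>x\<close> of the preimage \<open>F\<close> of
      \<open>{q e}\<close> gives a face \<open>{x} \<subseteq> F\<close>; its image is nonempty and
      inside \<open>{q e}\<close>, hence equal to it.\<close>
    obtain F where F: "F face_of P" "f F = {q e}"
      using surj vert e by blast
    then have "F \<noteq> {}" using f0 by auto
    moreover have "compact F" "convex F"
      using F(1) \<open>polytope P\<close> face_of_imp_compact polytope_imp_compact polytope_imp_convex
        face_of_imp_convex by blast+
    ultimately obtain x where "x extreme_point_of F"
      using extreme_point_exists_convex by blast
    then have "{x} face_of F" by (simp add: face_of_singleton)
    then have xP: "{x} face_of P" and "{x} \<subseteq> F"
      using F(1) face_of_trans face_of_imp_subset by blast+
    then have "f {x} \<subseteq> {q e}" using ord F by metis
    moreover have "f {x} \<noteq> {}"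
      using inj[of "{x}" "{}"] f0 xP by auto
    ultimately show ?thesis using xP by blast
  qed
  then obtain p where p: "\<And>e. e \<in> E \<Longrightarrow> {p e} face_of P" "\<And>e. e \<in> E \<Longrightarrow> f {p e} = {q e}"
    by metis
  \<comment> \<open>Membership of a vertex is inclusion of the face \<open>{p e}\<close>, so the
    order isomorphism preserves it.\<close>
  have mem: "p e \<in> F \<longleftrightarrow> q e \<in> f F" if "e \<in> E" "F face_of P" for e F
    using ord[OF p(1) that(2)] p(2) that(1) by simp
  have "{x. x extreme_point_of P} = p ` E"
  proof (rule antisym; rule subsetI)
    fix x assume "x \<in> {x. x extreme_point_of P}"
    then have x: "{x} face_of P" by (simp add: face_of_singleton)
    then have "f {x} \<noteq> {}" using inj[of "{x}" "{}"] f0 by auto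
    then obtain e where "e \<in> E" "q e \<in> f {x}" using ne fface x by blast
    then show "x \<in> p ` E" using mem x by blast
  next
    fix x assume "x \<in> p ` E"
    then show "x \<in> {x. x extreme_point_of P}" using p(1) by (auto simp: face_of_singleton)
  qed
  then have P: "P = convex hull (p ` E)"
    using Krein_Milman_Minkowski[of P] \<open>polytope P\<close> polytope_imp_compact polytope_imp_convex by metis
  show thesis
  proof
    show "P = convex hull (p ` E)" by (fact P)
    show "facial p E S" if S: "facial q E S" for S
    proof -
      obtain G where G: "G face_of ?Q" "S = {e \<in> E. q e \<in> G}"
        using S unfolding facial_def by blast
      then obtain F where "F face_of P" "f F = G" using surj by blast
      then show ?thesis
        unfolding facial_def P[symmetric] using mem G(2) by (intro exI[of _ F]) auto
    qed
    show "facial q E S" if S: "facial p E S" for S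
    proof -
      obtain F where F: "F face_of P" "S = {e \<in> E. p e \<in> F}"
        using S unfolding facial_def P[symmetric] by blast
      then show ?thesis
        unfolding facial_def using mem fface by (intro exI[of _ "f F"]) auto
    qed
  qed
qed

text \<open>A proper nonempty face lies in some facet of the polyhedron. The labels on that facet
  contain \<open>S\<close>, so by maximality they are \<open>S\<close> or \<open>E\<close>, and a
  facet is never the whole polytope.\<close>

lemma maximal_facial_facet:
  fixes p :: "'i \<Rightarrow> 'a::euclidean_space"
  assumes E: "finite E" and S: "facial p E S" "S \<noteq> {}" "S \<noteq> E"
    and max: "\<And>T. facial p E T \<Longrightarrow> S \<subseteq> T \<Longrightarrow> T = S \<or> T = E"
  shows "convex hull (p ` S) facet_of (convex hull (p ` E))"
proof -
  let ?P = "convex hull (p ` E)" and ?F = "convex hull (p ` S)"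
  note F = face_eq_hull_of_facial[OF E S(1)]
  have "?F \<noteq> ?P" using F(2) S(3) by (auto simp: hull_inc)
  moreover have "polyhedron ?P" using E by (simp add: polyhedron_convex_hull)
  moreover have "?F \<noteq> {}" using S(2) by simp
  ultimately obtain H where H: "H facet_of ?P" "?F \<subseteq> H"
    using F(1) face_of_polyhedron_subset_facet by metis
  have Hf: "H face_of ?P" using H(1) by (rule facet_of_imp_face_of)
  let ?T = "{e \<in> E. p e \<in> H}"
  have "S \<subseteq> ?T" using H(2) F(2) by blast
  moreover have "facial p E ?T" unfolding facial_def using Hf by blast
  ultimately consider "?T = S" | "?T = E" using max by blast
  then show ?thesis
  proof cases
    case 1
    then show ?thesis using H face_of_eq_hull_image[OF E Hf] by simp
  next
    case 2
    then have "H = ?P" using face_of_eq_hull_image[OF E Hf] by simp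
    then show ?thesis using H(1) by simp
  qed
qed

text \<open>On a segment inside the hull, \<open>g - k\<close> is nonnegative at both ends, so it
  can vanish at an interior point only if it vanishes at both. An abstract linear \<open>g\<close>
  lets the lemma apply to points of \<open>nat \<Rightarrow>\<^sub>0 real\<close> as well.\<close>

lemma facial_linear:
  fixes p :: "'i \<Rightarrow> 'a::real_vector"
  assumes g: "linear g" and nonneg: "\<And>e. e \<in> E \<Longrightarrow> g (p e) \<ge> (k::real)"
  shows "facial p E {e \<in> E. g (p e) = k}"
proof -
  let ?P = "convex hull (p ` E)"
  interpret linear g by fact
  have "convex {x. g x \<ge> k}" "convex {x. g x = k}"
    using convex_linear_vimage[OF g, of "{k..}"] convex_linear_vimage[OF g, of "{k}"]
    by (auto simp: vimage_def)
  note cv = this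
  have ge: "g x \<ge> k" if "x \<in> ?P" for x
    using that hull_minimal[of "p ` E" "{x. g x \<ge> k}" convex] cv(1) nonneg by blast
  have "?P \<inter> {x. g x = k} face_of ?P"
    unfolding face_of_def
  proof (intro conjI ballI impI)
    show "convex (?P \<inter> {x. g x = k})" using cv(2) by (simp add: convex_Int)
    fix a b x assume a: "a \<in> ?P" and b: "b \<in> ?P" and x: "x \<in> ?P \<inter> {x. g x = k}"
      and "x \<in> open_segment a b"
    then obtain u where u: "0 < u" "u < 1" "x = (1 - u) *\<^sub>R a + u *\<^sub>R b"
      by (auto simp: in_segment)
    have "(1 - u) * (g a - k) + u * (g b - k) = 0"
      using x by (simp add: u(3) add scale) (simp add: algebra_simps)
    moreover have "(1 - u) * (g a - k) \<ge> 0" "u * (g b - k) \<ge> 0"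
      using ge[OF a] ge[OF b] u by simp_all
    ultimately have "(1 - u) * (g a - k) = 0" "u * (g b - k) = 0" by linarith+
    then show "a \<in> ?P \<inter> {x. g x = k}" "b \<in> ?P \<inter> {x. g x = k}"
      using u a b by simp_all
  qed auto
  then show ?thesis
    unfolding facial_def by (intro exI[of _ "?P \<inter> {x. g x = k}"]) (auto simp: hull_inc)
qed

text \<open>Every face of a polyhedron is exposed, which gives a converse to
  \<open>facial_linear\<close> in Euclidean space.\<close>

lemma facial_exposed:
  fixes p :: "'i \<Rightarrow> 'a::euclidean_space"
  assumes "finite E" and "facial p E S"
  obtains c b where "\<And>e. e \<in> E \<Longrightarrow> c \<bullet> p e \<le> b" "S = {e \<in> E. c \<bullet> p e = b}"
proof -
  obtain F where F: "F face_of (convex hull (p ` E))" "S = {e \<in> E. p e \<in> F}"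
    using assms(2) unfolding facial_def by blast
  then have "F exposed_face_of (convex hull (p ` E))"
    using assms(1) by (simp add: exposed_face_of_polyhedron polyhedron_convex_hull)
  then obtain c b where "convex hull (p ` E) \<subseteq> {x. c \<bullet> x \<le> b}"
      "F = convex hull (p ` E) \<inter> {x. c \<bullet> x = b}"
    unfolding exposed_face_of_def by blast
  moreover have "p e \<in> convex hull (p ` E)" if "e \<in> E" for e
    using that by (simp add: hull_inc)
  ultimately show thesis
    using F(2) by (intro that[of c b]) blast+
qed

section \<open>Point configurations indexed by the edges of a complete graph\<close>

definition edges :: "nat \<Rightarrow> nat set set" where
  "edges N = {e. e \<subseteq> {..<N} \<and> card e = 2}"

text \<open>An empty \<open>A\<close> yields the empty face and \<open>A = {..<N}\<close> the whole
  polytope, so the improper faces count as cliques.\<close>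

definition clique_or_star :: "nat \<Rightarrow> nat set set \<Rightarrow> bool" where
  "clique_or_star N S \<longleftrightarrow>
     (\<exists>A. S = {e \<in> edges N. e \<subseteq> A}) \<or> (\<exists>i<N. S \<subseteq> {e \<in> edges N. i \<in> e})"

lemma finite_edges [simp]: "finite (edges N)"
  by (rule finite_subset[of _ "Pow {..<N}"]) (auto simp: edges_def)

lemma finite_edge: "e \<in> edges N \<Longrightarrow> finite e"
  unfolding edges_def using finite_subset[of e "{..<N}"] by simp

lemma edge_doubleton: "\<lbrakk>i < N; j < N; i \<noteq> j\<rbrakk> \<Longrightarrow> {i, j} \<in> edges N"
  by (auto simp: edges_def)

lemma edgeE:
  assumes "e \<in> edges N"
  obtains i j where "e = {i, j}" "i \<noteq> j" "i < N" "j < N"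
  using assms unfolding edges_def by (auto simp: card_2_iff)

lemma edge_other:
  assumes "e \<in> edges N" "i \<in> e"
  obtains j where "e = {i, j}" "i \<noteq> j" "j < N"
  using edgeE[OF assms(1)] assms(2) by (metis insertE insert_commute singletonD)

lemma clique_or_starI_clique: "clique_or_star N {e \<in> edges N. e \<subseteq> A}"
  unfolding clique_or_star_def by blast

lemma clique_or_starI_star: "i < N \<Longrightarrow> S \<subseteq> {e \<in> edges N. i \<in> e} \<Longrightarrow> clique_or_star N S"
  unfolding clique_or_star_def by blast

text \<open>A linear functional that is nonnegative on all points has at most one negative
  coordinate, so its zero set is a clique or part of a star.\<close>
lemma facial_imp_clique_or_star:
  fixes p :: "nat set \<Rightarrow> 'a::euclidean_space" and u :: "nat \<Rightarrow> 'a \<times> real"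
  assumes rep: "\<And>e. e \<in> edges N \<Longrightarrow> (p e, 1) = (\<Sum>i\<in>e. a e i *\<^sub>R u i)"
    and pos: "\<And>e i. e \<in> edges N \<Longrightarrow> i \<in> e \<Longrightarrow> a e i > (0::real)"
    and S: "facial p (edges N) S"
  shows "clique_or_star N S"
proof -
  obtain c b where c: "\<And>e. e \<in> edges N \<Longrightarrow> c \<bullet> p e \<le> b" "S = {e \<in> edges N. c \<bullet> p e = b}"
    using facial_exposed[OF _ S] by auto
  \<comment> \<open>\<open>h i\<close> is the value at \<open>u i\<close> of the functional
    \<open>(x, s) \<mapsto> b * s - c \<bullet> x\<close>, which at \<open>(p e, 1)\<close> is the
    slack of the supporting inequality.\<close>
  define h where "h i = (-c, b) \<bullet> u i" for i
  have bh: "b - c \<bullet> p e = (\<Sum>i\<in>e. a e i * h i)" if "e \<in> edges N" for e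
  proof -
    have "b - c \<bullet> p e = (-c, b) \<bullet> (p e, 1)" by simp
    also have "\<dots> = (\<Sum>i\<in>e. a e i * h i)"
      unfolding rep[OF that] inner_sum_right h_def by simp
    finally show ?thesis .
  qed
  have nonneg: "(\<Sum>i\<in>e. a e i * h i) \<ge> 0" if "e \<in> edges N" for e
    using c(1)[OF that] bh[OF that] by simp
  have S0: "S = {e \<in> edges N. (\<Sum>i\<in>e. a e i * h i) = 0}"
    unfolding c(2) by (auto simp: bh[symmetric])
  show ?thesis
  proof (cases "\<forall>i<N. h i \<ge> 0")
    case True
    have "(\<Sum>i\<in>e. a e i * h i) = 0 \<longleftrightarrow> e \<subseteq> {i. h i = 0}" if e: "e \<in> edges N" for e
    proof -
      have "a e i * h i \<ge> 0" if "i \<in> e" for i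
        using that True e pos[OF e that] by (auto simp: edges_def)
      then have "(\<Sum>i\<in>e. a e i * h i) = 0 \<longleftrightarrow> (\<forall>i\<in>e. a e i * h i = 0)"
        using sum_nonneg_eq_0_iff[OF finite_edge[OF e], of "\<lambda>i. a e i * h i"] by auto
      also have "\<dots> \<longleftrightarrow> e \<subseteq> {i. h i = 0}"
        using pos[OF e] by fastforce
      finally show ?thesis .
    qed
    then have "S = {e \<in> edges N. e \<subseteq> {i. h i = 0}}" unfolding S0 by blast
    then show ?thesis using clique_or_starI_clique by simp
  next
    case False
    then obtain i where i: "i < N" "h i < 0" by auto
    \<comment> \<open>Since \<open>h i < 0\<close>, nonnegativity on the edge \<open>{i, j}\<close>
      forces \<open>h j > 0\<close>; edges missing \<open>i\<close> then have strictly positive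
      slack.\<close>
    have hpos: "h j > 0" if "j < N" "j \<noteq> i" for j
    proof -
      have e: "{i, j} \<in> edges N" using i that by (simp add: edge_doubleton)
      have "a {i, j} i * h i + a {i, j} j * h j \<ge> 0"
        using nonneg[OF e] that by simp
      moreover have "a {i, j} i * h i < 0" using pos[OF e, of i] i by (simp add: mult_pos_neg)
      ultimately have "a {i, j} j * h j > 0" by linarith
      then show ?thesis using pos[OF e, of j] by (simp add: zero_less_mult_iff)
    qed
    have "i \<in> e" if "e \<in> S" for e
    proof (rule ccontr)
      assume "i \<notin> e"
      from that have e: "e \<in> edges N" and e0: "(\<Sum>i\<in>e. a e i * h i) = 0" unfolding S0 by auto
      from e obtain j k where jk: "e = {j, k}" "j \<noteq> k" "j < N" "k < N" by (rule edgeE)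
      have "a e j * h j > 0" "a e k * h k > 0"
        using jk \<open>i \<notin> e\<close> pos[OF e] hpos by auto
      then show False using e0 jk by simp
    qed
    then show ?thesis using i(1) S0 by (intro clique_or_starI_star[of i]) auto
  qed
qed

text \<open>By \<open>dual\<close>, a functional can take any prescribed values \<open>h\<close> at
  the vectors \<open>u i\<close>. So it is enough to find \<open>h\<close> whose
  \<open>a\<close>-weighted sums are nonnegative on all edges and vanish exactly on
  \<open>S\<close>.\<close>

lemma clique_or_star_imp_facial:
  fixes p :: "nat set \<Rightarrow> 'a::real_vector" and u :: "nat \<Rightarrow> 'a \<times> real"
  assumes rep: "\<And>e. e \<in> edges N \<Longrightarrow> (p e, 1) = (\<Sum>i\<in>e. a e i *\<^sub>R u i)"
    and pos: "\<And>e i. e \<in> edges N \<Longrightarrow> i \<in> e \<Longrightarrow> a e i > (0::real)"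
    and dual: "\<And>h :: nat \<Rightarrow> real. \<exists>g. linear g \<and> (\<forall>i<N. g (u i) = h i)"
    and S: "clique_or_star N S"
  shows "facial p (edges N) S"
proof -
  have *: "facial p (edges N) {e \<in> edges N. (\<Sum>i\<in>e. a e i * h i) = 0}"
    if nonneg: "\<And>e. e \<in> edges N \<Longrightarrow> (\<Sum>i\<in>e. a e i * h i) \<ge> 0" for h :: "nat \<Rightarrow> real"
  proof -
    obtain g where g: "linear g" "\<forall>i<N. g (u i) = h i" using dual by blast
    interpret linear g by fact
    \<comment> \<open>Since \<open>g (x, 1) = g (x, 0) + g (0, 1)\<close>, the homogeneous zero set
      becomes the affine condition \<open>g (x, 0) = - g (0, 1)\<close> on the points
      \<open>p e\<close>.\<close>
    have gh: "g (p e, 0) - - g (0, 1) = (\<Sum>i\<in>e. a e i * h i)" if e: "e \<in> edges N" for e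
    proof -
      have "g (p e, 0) - - g (0, 1) = g (p e, 1)" using add[of "(p e, 0)" "(0, 1)"] by simp
      also have "\<dots> = (\<Sum>i\<in>e. a e i * g (u i))" unfolding rep[OF e] sum scale by simp
      also have "\<dots> = (\<Sum>i\<in>e. a e i * h i)"
        using g(2) e by (intro sum.cong) (auto simp: edges_def)
      finally show ?thesis .
    qed
    have lin: "linear (\<lambda>x. g (x, 0))"
      by (rule linear_compose[of "\<lambda>x. (x, 0)" g, unfolded o_def])
         (auto simp: g(1) intro!: linearI)
    have "facial p (edges N) {e \<in> edges N. g (p e, 0) = - g (0, 1)}"
      by (rule facial_linear[OF lin]) (use gh nonneg in fastforce)
    moreover have "g (p e, 0) = - g (0, 1) \<longleftrightarrow> (\<Sum>i\<in>e. a e i * h i) = 0" if "e \<in> edges N" for e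
      using gh[OF that] by linarith
    then have "{e \<in> edges N. g (p e, 0) = - g (0, 1)} = {e \<in> edges N. (\<Sum>i\<in>e. a e i * h i) = 0}"
      by blast
    ultimately show ?thesis by simp
  qed
  from S consider A where "S = {e \<in> edges N. e \<subseteq> A}"
    | i where "i < N" "S \<subseteq> {e \<in> edges N. i \<in> e}"
    unfolding clique_or_star_def by blast
  then show ?thesis
  proof cases
    case 1
    define h :: "nat \<Rightarrow> real" where "h i = (if i \<in> A then 0 else 1)" for i
    have nn: "a e i * h i \<ge> 0" if "e \<in> edges N" "i \<in> e" for e i
      using pos[OF that] by (simp add: h_def)
    have "(\<Sum>i\<in>e. a e i * h i) = 0 \<longleftrightarrow> e \<subseteq> A" if e: "e \<in> edges N" for e
    proof -
      have "(\<Sum>i\<in>e. a e i * h i) = 0 \<longleftrightarrow> (\<forall>i\<in>e. a e i * h i = 0)"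
        using sum_nonneg_eq_0_iff[OF finite_edge[OF e], of "\<lambda>i. a e i * h i"] nn[OF e] by auto
      moreover have "a e i * h i = 0 \<longleftrightarrow> i \<in> A" if "i \<in> e" for i
        using pos[OF e that] by (simp add: h_def)
      ultimately show ?thesis by blast
    qed
    then have "S = {e \<in> edges N. (\<Sum>i\<in>e. a e i * h i) = 0}" using 1 by blast
    then show ?thesis using *[of h] nn by (simp add: sum_nonneg)
  next
    case 2
    \<comment> \<open>The only negative value is at the centre \<open>i\<close>. The quotient makes
      the sum over \<open>{i, j}\<close> cancel exactly; the extra 1 leaves
      \<open>a {i, j} j\<close> when that edge is not in \<open>S\<close>.\<close>
    define h where "h j = (if j = i then - 1 else a {i, j} i / a {i, j} j + (if {i, j} \<in> S then 0 else 1))" for j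
    have hpos: "h j > 0" if "j < N" "j \<noteq> i" for j
      using pos[of "{i, j}" i] pos[of "{i, j}" j] that 2(1) edge_doubleton[of i N j]
      by (simp add: h_def add_pos_nonneg)
    have val: "(\<Sum>k\<in>e. a e k * h k) \<ge> 0" "(\<Sum>k\<in>e. a e k * h k) = 0 \<longleftrightarrow> e \<in> S"
      if e: "e \<in> edges N" for e
    proof -
      have "(\<Sum>k\<in>e. a e k * h k) \<ge> 0 \<and> ((\<Sum>k\<in>e. a e k * h k) = 0 \<longleftrightarrow> e \<in> S)"
      proof (cases "i \<in> e")
        case True
        with e obtain j where j: "e = {i, j}" "i \<noteq> j" "j < N" by (rule edge_other)
        have "a e j > 0" using pos[OF e] j by simp
        moreover have "(\<Sum>k\<in>e. a e k * h k) = (if e \<in> S then 0 else a e j)"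
          using j(2) \<open>a e j > 0\<close> unfolding j(1) by (simp add: h_def field_simps)
        ultimately show ?thesis by auto
      next
        case False
        from e obtain j k where jk: "e = {j, k}" "j \<noteq> k" "j < N" "k < N" by (rule edgeE)
        have "a e j * h j > 0" "a e k * h k > 0"
          using jk False pos[OF e] hpos by auto
        then show ?thesis using jk False 2(2) by auto
      qed
      then show "(\<Sum>k\<in>e. a e k * h k) \<ge> 0" "(\<Sum>k\<in>e. a e k * h k) = 0 \<longleftrightarrow> e \<in> S" by auto
    qed
    have "S = {e \<in> edges N. (\<Sum>i\<in>e. a e i * h i) = 0}" using 2(2) val(2) by blast
    then show ?thesis using *[of h] val(1) by simp
  qed
qed

text \<open>The three edges of the triangle on 0, 1, 2 have no common node, so \<open>T\<close> is
  not inside a star. A clique containing \<open>edges n\<close> includes all nodes below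
  \<open>n\<close>, and only the node \<open>n\<close> is left to decide.\<close>

lemma clique_or_star_maximal_clique:
  assumes "n \<ge> 3" and T: "clique_or_star (n + 1) T" and sub: "edges n \<subseteq> T"
  shows "T = edges n \<or> T = edges (n + 1)"
proof -
  have mem: "{0, 1} \<in> T" "{0, 2} \<in> T" "{1, 2} \<in> T"
    using assms(1) sub edge_doubleton[of _ n] by auto
  from T consider A where "T = {e \<in> edges (n + 1). e \<subseteq> A}"
    | i where "i < n + 1" "T \<subseteq> {e \<in> edges (n + 1). i \<in> e}"
    unfolding clique_or_star_def by blast
  then show ?thesis
  proof cases
    case 1
    have A: "i \<in> A" if "i < n" for i
    proof -
      obtain j where "j < n" "j \<noteq> i" using assms(1) that[of "if i = 0 then 1 else 0"] by auto
      then have "{i, j} \<in> T" using sub that edge_doubleton by blast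
      then show ?thesis using 1 by simp
    qed
    have split: "{..<n + 1} = insert n {..<n}" by auto
    have "e \<in> edges n \<longleftrightarrow> e \<subseteq> A" if "n \<notin> A" "e \<in> edges (n + 1)" for e
      using that A unfolding edges_def split by blast
    moreover have "e \<subseteq> A" if "n \<in> A" "e \<in> edges (n + 1)" for e
      using that A unfolding edges_def split by blast
    moreover have "edges n \<subseteq> edges (n + 1)" unfolding edges_def by auto
    ultimately show ?thesis unfolding 1 by blast
  next
    case 2
    then have "i \<in> {0, 1}" "i \<in> {0, 2}" "i \<in> {1, 2}" using mem by blast+
    then show ?thesis by auto
  qed
qed

text \<open>Only 0 is common to the edges \<open>{0, 1}\<close> and \<open>{0, 2}\<close>, so no
  other star contains this one; a clique containing it includes all nodes below
  \<open>n\<close>.\<close>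

lemma clique_or_star_maximal_star:
  assumes "n \<ge> 3" and T: "clique_or_star n T" and sub: "{e \<in> edges n. 0 \<in> e} \<subseteq> T"
  shows "T = {e \<in> edges n. 0 \<in> e} \<or> T = edges n"
proof -
  have mem: "{0, i} \<in> T" if "i < n" "i \<noteq> 0" for i
    using sub edge_doubleton[of 0 n i] that by auto
  from T consider A where "T = {e \<in> edges n. e \<subseteq> A}"
    | i where "i < n" "T \<subseteq> {e \<in> edges n. i \<in> e}"
    unfolding clique_or_star_def by blast
  then show ?thesis
  proof cases
    case 1
    have "i \<in> A" if "i < n" for i
      using mem[of i] mem[of 1] 1 that assms(1) by (cases "i = 0") auto
    then have "e \<subseteq> A" if "e \<in> edges n" for e
      using that unfolding edges_def by blast
    then show ?thesis using 1 by blast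
  next
    case 2
    have "{0, 1} \<in> T" "{0, 2} \<in> T" using mem assms(1) by auto
    then have "i \<in> {0, 1}" "i \<in> {0, 2}" using 2(2) by blast+
    then have "i = 0" by auto
    then show ?thesis using 2 sub by blast
  qed
qed

section \<open>The second hypersimplex\<close>

definition edge_vertex :: "nat set \<Rightarrow> (nat \<Rightarrow>\<^sub>0 real)" where
  "edge_vertex e = (\<Sum>i\<in>e. Poly_Mapping.single i 1)"

lemma lookup_scaleR_poly_mapping:
  "Poly_Mapping.lookup (r *\<^sub>R x) i = r *\<^sub>R Poly_Mapping.lookup (x :: 'k \<Rightarrow>\<^sub>0 'b::real_vector) i"
proof -
  have "finite {i. r *\<^sub>R Poly_Mapping.lookup x i \<noteq> 0}"
    by (rule finite_subset[OF _ finite_keys[of x]]) (auto simp: in_keys_iff)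
  then show ?thesis by (simp add: scaleR_poly_mapping_def)
qed

lemma lookup_edge_vertex:
  "finite e \<Longrightarrow> Poly_Mapping.lookup (edge_vertex e) i = (if i \<in> e then 1 else 0)"
  unfolding edge_vertex_def lookup_sum lookup_single when_def by (simp add: sum.delta')

lemma edge_vertex_eq_iff:
  "finite e \<Longrightarrow> finite e' \<Longrightarrow> edge_vertex e = edge_vertex e' \<longleftrightarrow> e = e'"
  by (auto simp: poly_mapping_eq_iff fun_eq_iff lookup_edge_vertex split: if_splits)

lemma hypersimplex_2_eq: "hypersimplex n 2 = convex hull (edge_vertex ` edges n)"
proof -
  have "{x :: nat \<Rightarrow>\<^sub>0 real. Poly_Mapping.keys x \<subseteq> {..<n} \<and>
           (\<forall>i<n. Poly_Mapping.lookup x i \<in> {0, 1}) \<and>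
           (\<Sum>i<n. Poly_Mapping.lookup x i) = real 2} = edge_vertex ` edges n" (is "?X = _")
  proof (rule antisym; rule subsetI)
    fix x :: "nat \<Rightarrow>\<^sub>0 real" assume x: "x \<in> ?X"
    define e where "e = {i. i < n \<and> Poly_Mapping.lookup x i = 1}"
    have "x = edge_vertex e"
      by (rule poly_mapping_eqI, subst lookup_edge_vertex)
         (use x in \<open>auto simp: e_def in_keys_iff subset_iff\<close>)
    moreover have "{..<n} \<inter> e = e" "finite e" by (auto simp: e_def)
    then have "real (card e) = (\<Sum>i<n. Poly_Mapping.lookup x i)"
      using \<open>x = edge_vertex e\<close> by (simp add: lookup_edge_vertex sum.If_cases)
    then have "card e = 2" using x by simp
    ultimately show "x \<in> edge_vertex ` edges n"
      unfolding edges_def by (auto simp: e_def)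
  next
    fix x :: "nat \<Rightarrow>\<^sub>0 real" assume "x \<in> edge_vertex ` edges n"
    then obtain e where e: "e \<in> edges n" "x = edge_vertex e" by blast
    have l: "Poly_Mapping.lookup x i = (if i \<in> e then 1 else 0)" for i
      using lookup_edge_vertex[OF finite_edge[OF e(1)]] e(2) by simp
    have "{..<n} \<inter> e = e" "card e = 2" using e(1) by (auto simp: edges_def)
    then show "x \<in> ?X"
      using e(1) l by (auto simp: edges_def in_keys_iff sum.If_cases split: if_splits)
  qed
  then show ?thesis unfolding hypersimplex_def by simp
qed

text \<open>The relation \<open>v\<^sub>a\<^sub>b + v\<^sub>c\<^sub>d = v\<^sub>a\<^sub>c + v\<^sub>b\<^sub>d\<close> gives two segments with a common midpoint.\<close>
lemma facial_edge_vertex_exchange: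
  assumes S: "facial edge_vertex (edges N) S"
    and ab: "{a, b} \<in> S" and cd: "{c, d} \<in> S" and disj: "{a, b} \<inter> {c, d} = {}"
  shows "{a, c} \<in> S"
proof -
  obtain F where F: "F face_of (convex hull (edge_vertex ` edges N))"
    "S = {e \<in> edges N. edge_vertex e \<in> F}"
    using S unfolding facial_def by blast
  have ed: "{a, b} \<in> edges N" "{c, d} \<in> edges N" using ab cd F(2) by auto
  then have "a \<noteq> b" "c \<noteq> d" "a < N" "b < N" "c < N" "d < N"
    by (auto simp: edges_def card_2_iff doubleton_eq_iff)
  then have e: "{a, c} \<in> edges N" "{b, d} \<in> edges N"
    using disj by (auto intro: edge_doubleton)
  have ne: "edge_vertex {a, c} \<noteq> edge_vertex {b, d}"
    using disj \<open>a \<noteq> b\<close> by (auto simp: edge_vertex_eq_iff doubleton_eq_iff)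
  define m where "m = (1/2) *\<^sub>R edge_vertex {a, c} + (1/2) *\<^sub>R edge_vertex {b, d}"
  have "m = (1/2) *\<^sub>R edge_vertex {a, b} + (1/2) *\<^sub>R edge_vertex {c, d}"
    unfolding m_def using disj \<open>a \<noteq> b\<close> \<open>c \<noteq> d\<close> by (auto simp: edge_vertex_def algebra_simps)
  moreover have "convex F" using F(1) by (rule face_of_imp_convex)
  ultimately have "m \<in> F"
    using ab cd F(2) by (auto intro: convexD)
  moreover have "m \<in> open_segment (edge_vertex {a, c}) (edge_vertex {b, d})"
    unfolding in_segment m_def using ne by (intro conjI exI[of _ "1/2"]) auto
  ultimately have "edge_vertex {a, c} \<in> F"
    using face_ofD[OF F(1) _ _ _ \<open>m \<in> F\<close>] e by (simp add: hull_inc)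
  then show ?thesis using e F(2) by blast
qed

text \<open>If no node is common to all edges of \<open>S\<close>, exchanging disjoint edges shows
  that any two nodes covered by \<open>S\<close> are joined in \<open>S\<close>, so \<open>S\<close>
  is the clique on \<open>\<Union>S\<close>.\<close>

lemma facial_edge_vertex_imp:
  assumes S: "facial edge_vertex (edges N) S"
  shows "clique_or_star N S"
proof (cases "\<exists>i<N. \<forall>e\<in>S. i \<in> e")
  case True
  moreover have "S \<subseteq> edges N" using S unfolding facial_def by blast
  ultimately show ?thesis using clique_or_starI_star by blast
next
  case False
  have SE: "S \<subseteq> edges N" using S unfolding facial_def by blast
  note exch = facial_edge_vertex_exchange[OF S]
  have "{x, y} \<in> S" if xy: "x \<in> \<Union>S" "y \<in> \<Union>S" "x \<noteq> y" for x y
  proof (rule ccontr)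
    assume notin: "{x, y} \<notin> S"
    have partner: "\<exists>z<N. {x, z} \<in> S \<and> x \<noteq> z" if x: "x \<in> \<Union>S" for x
    proof -
      obtain e where e: "e \<in> S" "x \<in> e" using x by blast
      then show ?thesis using SE edge_other[of e N x] by blast
    qed
    obtain z w where z: "{x, z} \<in> S" "x \<noteq> z" "z < N" and w: "{y, w} \<in> S" "y \<noteq> w"
      using partner[OF xy(1)] partner[OF xy(2)] by blast
    \<comment> \<open>If \<open>z \<noteq> w\<close>, the edges \<open>{x, z}\<close> and
      \<open>{y, w}\<close> are disjoint because neither is \<open>{x, y}\<close>, and the exchange
      would produce \<open>{x, y}\<close>.\<close>
    have "z = w" using exch[OF z(1) w(1)] notin xy(3) z w by (auto simp: insert_commute)
    obtain e where e: "e \<in> S" "z \<notin> e" using False z(3) by blast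
    \<comment> \<open>Otherwise \<open>e\<close> is disjoint from \<open>{x', z}\<close>, and the
      exchange joins \<open>x'\<close> to both ends of \<open>e\<close>. Neither end is
      \<open>y'\<close>, so exchanging \<open>{x', s}\<close> with \<open>{y', z}\<close> would join
      \<open>x'\<close> to \<open>y'\<close>. Applied to \<open>x\<close> and \<open>y\<close> this
      forces \<open>e = {x, y}\<close>.\<close>
    have **: "x' \<in> e" if "{x', z} \<in> S" "{y', z} \<in> S" "x' \<noteq> z" "y' \<noteq> z" "x' \<noteq> y'" "{x', y'} \<notin> S" for x' y'
    proof (rule ccontr)
      assume "x' \<notin> e"
      obtain s t where st: "e = {s, t}" "s \<noteq> t" using e(1) SE by (blast elim: edgeE)
      have "s \<noteq> y'" "t \<noteq> y'"
        using exch[OF that(1), of s t] exch[OF that(1), of t s] e st \<open>x' \<notin> e\<close> that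
        by (auto simp: insert_commute)
      have "{x', s} \<in> S"
        using exch[OF that(1), of s t] e st \<open>x' \<notin> e\<close> by auto
      then have "{x', y'} \<in> S"
        using exch[of x' s y' z] that \<open>s \<noteq> y'\<close> e st by auto
      then show False using that by blast
    qed
    have "x \<in> e" "y \<in> e"
      using **[of x y] **[of y x] z w \<open>z = w\<close> xy(3) notin by (auto simp: insert_commute)
    moreover have "e \<in> edges N" using e(1) SE by blast
    ultimately have "e = {x, y}" using xy(3) by (auto elim!: edgeE)
    then show False using e(1) notin by blast
  qed
  then have "e \<in> S" if "e \<in> edges N" "e \<subseteq> \<Union>S" for e
    using that by (auto elim!: edgeE)
  then have "S = {e \<in> edges N. e \<subseteq> \<Union>S}" using SE by blast
  then show ?thesis using clique_or_starI_clique by metis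
qed

lemma facial_edge_vertex_iff:
  "facial edge_vertex (edges N) S \<longleftrightarrow> clique_or_star N S"
proof
  \<comment> \<open>Height 1/2 lets the two ends of an edge add up to height 1, with all
    coefficients equal to 1.\<close>
  define u :: "nat \<Rightarrow> (nat \<Rightarrow>\<^sub>0 real) \<times> real" where "u i = (Poly_Mapping.single i 1, 1 / 2)" for i
  assume S: "clique_or_star N S"
  show "facial edge_vertex (edges N) S"
  proof (rule clique_or_star_imp_facial[OF _ _ _ S, where a = "\<lambda>_ _. 1" and u = u])
    show "(edge_vertex e, 1) = (\<Sum>i\<in>e. 1 *\<^sub>R u i)" if "e \<in> edges N" for e
      using that by (auto simp: edges_def u_def edge_vertex_def prod_eq_iff fst_sum snd_sum)
    show "\<exists>g. linear g \<and> (\<forall>i<N. g (u i) = h i)" for h :: "nat \<Rightarrow> real"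
    proof (intro exI conjI)
      let ?g = "\<lambda>x :: (nat \<Rightarrow>\<^sub>0 real) \<times> real. \<Sum>i<N. Poly_Mapping.lookup (fst x) i * h i"
      show "linear ?g"
        by (rule linearI) (auto simp: lookup_add lookup_scaleR_poly_mapping sum.distrib algebra_simps sum_distrib_left)
      show "\<forall>i<N. ?g (u i) = h i"
        by (auto simp: u_def lookup_single when_def if_distrib[of "\<lambda>x. x * _"] cong: if_cong)
    qed
  qed simp
qed (rule facial_edge_vertex_imp)

text \<open>The clique on the two nodes of \<open>e\<close> has no other edge. This supplies the
  vertex hypothesis of \<open>face_lattice_isomorphicE\<close>.\<close>

lemma edge_vertex_face:
  assumes "e \<in> edges N"
  shows "{edge_vertex e} face_of (convex hull (edge_vertex ` edges N))"
proof -
  have "{e' \<in> edges N. e' \<subseteq> e} = {e}"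
    using assms card_subset_eq[OF finite_edge[OF assms]] by (auto simp: edges_def)
  then have "facial edge_vertex (edges N) {e}"
    using clique_or_starI_clique[of N e] by (simp add: facial_edge_vertex_iff)
  from face_eq_hull_of_facial(1)[OF finite_edges this] show ?thesis by simp
qed

section \<open>Homogeneous coordinates of a combinatorial second hypersimplex\<close>

text \<open>The star at \<open>0\<close> has \<open>n - 1\<close> vertices and is a facet, which bounds the dimension.\<close>
lemma aff_dim_clique_or_star:
  fixes p :: "nat set \<Rightarrow> 'a::euclidean_space"
  assumes n: "n \<ge> 3" and fac: "\<And>S. facial p (edges n) S \<longleftrightarrow> clique_or_star n S"
  shows "aff_dim (p ` edges n) \<le> int n - 1"
proof -
  define S where "S = {e \<in> edges n. 0 \<in> e}"
  have "{0, 1} \<in> S" "{1, 2} \<in> edges n" "{1, 2} \<notin> S"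
    using n by (auto simp: S_def edge_doubleton)
  then have "S \<noteq> {}" "S \<noteq> edges n" by blast+
  moreover have "facial p (edges n) S"
    unfolding fac S_def using n by (intro clique_or_starI_star[of 0]) auto
  ultimately have "convex hull (p ` S) facet_of (convex hull (p ` edges n))"
    using clique_or_star_maximal_star[OF n] fac by (intro maximal_facial_facet) (auto simp: S_def)
  then have eq: "aff_dim (p ` S) = aff_dim (p ` edges n) - 1"
    by (simp add: facet_of_def aff_dim_convex_hull)
  have fin: "finite S" by (simp add: S_def)
  have "S \<subseteq> (\<lambda>j. {0, j}) ` {1..<n}"
  proof
    fix e assume "e \<in> S"
    then have "e \<in> edges n" "0 \<in> e" by (auto simp: S_def)
    then obtain j where "e = {0, j}" "0 \<noteq> j" "j < n" by (rule edge_other)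
    then show "e \<in> (\<lambda>j. {0, j}) ` {1..<n}" by (auto simp: image_iff)
  qed
  then have "card S \<le> card ((\<lambda>j. {0::nat, j}) ` {1..<n})"
    by (intro card_mono) auto
  also have "\<dots> \<le> n - 1" using card_image_le[of "{1..<n}" "\<lambda>j. {0::nat, j}"] by simp
  finally have "card (p ` S) \<le> n - 1" using card_image_le[OF fin, of p] by linarith
  \<comment> \<open>At most \<open>n - 1\<close> points have affine dimension at most
    \<open>n - 2\<close>, and a facet has dimension one less than its polytope.\<close>
  then have "aff_dim (p ` S) \<le> int n - 2"
    using aff_dim_le_card[of "p ` S"] fin n by simp
  then show ?thesis using eq by simp
qed

text \<open>For a base point \<open>x0\<close>, the lifted points are spanned by
  \<open>(x0, 1)\<close> and the differences \<open>x - x0\<close> at height 0, whose span has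
  dimension \<open>aff_dim X\<close>.\<close>

lemma dim_homogenization_le:
  fixes X :: "'a::euclidean_space set"
  shows "int (dim ((\<lambda>x. (x, 1 :: real)) ` X)) \<le> aff_dim X + 1"
proof (cases "X = {}")
  case False
  then obtain x0 where x0: "x0 \<in> X" by blast
  define Y where "Y = (\<lambda>x. - x0 + x) ` X"
  let ?B = "insert (x0, 1) ((\<lambda>x. (x, 0 :: real)) ` Y)"
  have "(x, 1) \<in> span ?B" if "x \<in> X" for x
  proof -
    have "(- x0 + x, 0) \<in> ?B" using that by (auto simp: Y_def)
    then have "(x0, 1) + (- x0 + x, 0) \<in> span ?B" by (intro span_add span_base) auto
    then show ?thesis by simp
  qed
  then have "dim ((\<lambda>x. (x, 1 :: real)) ` X) \<le> dim ?B"
    by (intro dim_subset[of _ "span ?B", unfolded dim_span]) auto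
  also have "\<dots> \<le> dim ((\<lambda>x. (x, 0 :: real)) ` Y) + 1"
    by (simp add: dim_insert)
  also have "dim ((\<lambda>x. (x, 0 :: real)) ` Y) \<le> dim Y"
    by (intro dim_image_le linearI) auto
  finally show ?thesis
    using aff_dim_eq_dim[of x0 X] x0 by (simp add: hull_inc Y_def)
qed simp

text \<open>The coordinates are affine functionals exposing the faces given by the cliques avoiding one
  index. The dual vectors exist because the three edges of a triangle span a space of dimension
  three; they span the whole homogenization for dimension reasons.\<close>
lemma edge_coordinates:
  fixes p :: "nat set \<Rightarrow> 'a::euclidean_space"
  assumes n: "n \<ge> 3" and fac: "\<And>S. facial p (edges n) S \<longleftrightarrow> clique_or_star n S"
  obtains a and v :: "nat \<Rightarrow> 'a \<times> real"
  where "\<And>e. e \<in> edges n \<Longrightarrow> (p e, 1) = (\<Sum>i\<in>e. a e i *\<^sub>R v i)"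
    "\<And>e i. e \<in> edges n \<Longrightarrow> i \<in> e \<Longrightarrow> a e i > (0::real)"
    "\<And>h :: nat \<Rightarrow> real. \<exists>g. linear g \<and> (\<forall>i<n. g (v i) = h i)"
proof -
  have "\<exists>m :: 'a \<times> real. \<forall>e\<in>edges n. m \<bullet> (p e, 1) \<ge> 0 \<and> (m \<bullet> (p e, 1) = 0 \<longleftrightarrow> i \<notin> e)" for i
  proof -
    have "facial p (edges n) {e \<in> edges n. e \<subseteq> - {i}}"
      unfolding fac by (rule clique_or_starI_clique)
    then obtain c b where c: "\<And>e. e \<in> edges n \<Longrightarrow> c \<bullet> p e \<le> b"
      "{e \<in> edges n. e \<subseteq> - {i}} = {e \<in> edges n. c \<bullet> p e = b}"
      by (rule facial_exposed[OF finite_edges]) blast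
    have "c \<bullet> p e = b \<longleftrightarrow> i \<notin> e" if "e \<in> edges n" for e using c(2) that by blast
    then show ?thesis using c(1) by (intro exI[of _ "(- c, b)"]) auto
  qed
  then obtain m :: "nat \<Rightarrow> 'a \<times> real"
    where m: "\<And>i e. e \<in> edges n \<Longrightarrow> m i \<bullet> (p e, 1) \<ge> 0"
      "\<And>i e. e \<in> edges n \<Longrightarrow> m i \<bullet> (p e, 1) = 0 \<longleftrightarrow> i \<notin> e"
    by metis
  define H where "H e = (p e, 1 :: real)" for e
  define a where "a e i = m i \<bullet> H e" for e i
  have pos: "a e i > 0" if "e \<in> edges n" "i \<in> e" for e i
    using m[OF that(1), of i] that(2) unfolding a_def H_def by (simp add: less_le)
  have zero: "a e i = 0" if "e \<in> edges n" "i \<notin> e" for e i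
    using m[OF that(1), of i] that(2) unfolding a_def H_def by simp
  have tri: "{0, 1} \<in> edges n" "{0, 2} \<in> edges n" "{1, 2} \<in> edges n"
    using n by (auto intro: edge_doubleton)
  \<comment> \<open>In the combination of \<open>H {0, 1}\<close>, \<open>H {0, 2}\<close>,
    \<open>H {1, 2}\<close> with coefficients \<open>x\<close>, \<open>y\<close>,
    \<open>- z\<close>, the coordinates 1 and 2 cancel; its coordinate 0 is \<open>d > 0\<close>,
    and dividing by \<open>d\<close> gives the vector dual to \<open>m 0\<close>.\<close>
  define x where "x = a {1, 2} 1 * a {0, 2} 2"
  define y where "y = a {1, 2} 2 * a {0, 1} 1"
  define z where "z = a {0, 1} 1 * a {0, 2} 2"
  define d where "d = x * a {0, 1} 0 + y * a {0, 2} 0"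
  have "d > 0" unfolding d_def x_def y_def using pos tri by (intro add_pos_pos mult_pos_pos) auto
  define v0 where "v0 = (1 / d) *\<^sub>R (x *\<^sub>R H {0, 1} + y *\<^sub>R H {0, 2} - z *\<^sub>R H {1, 2})"
  \<comment> \<open>The edge \<open>{0, j}\<close> involves only the coordinates 0 and
    \<open>j\<close>; removing its part along \<open>v0\<close> and rescaling leaves the vector dual
    to \<open>m j\<close>.\<close>
  define v where "v j = (if j = 0 then v0
    else (1 / a {0, j} j) *\<^sub>R (H {0, j} - a {0, j} 0 *\<^sub>R v0))" for j
  have mv0: "m k \<bullet> v0 = (if k = 0 then 1 else 0)" for k
  proof -
    have "m k \<bullet> v0 = (x * a {0, 1} k + y * a {0, 2} k - z * a {1, 2} k) / d"
      unfolding v0_def a_def by (simp add: inner_simps)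
    also have "\<dots> = (if k = 0 then 1 else 0)"
    proof -
      consider "k = 0" | "k = 1" | "k = 2" | "k \<notin> {0, 1, 2}" by blast
      then show ?thesis
      proof cases
        case 1
        then show ?thesis using \<open>d > 0\<close> zero[OF tri(3), of 0] by (simp add: d_def)
      next
        case 2
        then show ?thesis using zero[OF tri(2), of 1] by (simp add: x_def z_def)
      next
        case 3
        then show ?thesis using zero[OF tri(1), of 2] by (simp add: y_def z_def)
      next
        case 4
        then show ?thesis using zero tri by simp
      qed
    qed
    finally show ?thesis .
  qed
  have mv: "m k \<bullet> v j = (if k = j then 1 else 0)" if "j < n" for k j
  proof (cases "j = 0")
    case False
    have e: "{0, j} \<in> edges n" using False that by (auto intro: edge_doubleton)
    have "m k \<bullet> v j = (a {0, j} k - a {0, j} 0 * (m k \<bullet> v0)) / a {0, j} j"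
      using False by (simp add: v_def inner_simps a_def)
    then show ?thesis
      using False mv0[of k] zero[OF e, of k] pos[OF e, of j] by (cases "k = j"; cases "k = 0") auto
  qed (simp add: v_def mv0)
  define W where "W = span (H ` edges n)"
  have v0W: "v0 \<in> W"
    unfolding v0_def W_def using tri by (intro span_scale span_diff span_add span_base) auto
  have vW: "v j \<in> W" if "j < n" for j
  proof (cases "j = 0")
    case False
    then have "{0, j} \<in> edges n" using that by (intro edge_doubleton) auto
    then have "H {0, j} \<in> W" unfolding W_def by (intro span_base) auto
    then show ?thesis
      using False v0W by (simp add: v_def W_def span_scale span_diff)
  qed (simp add: v_def v0W)
  have inj: "inj_on v {..<n}"
  proof (rule inj_onI)
    fix i j assume "i \<in> {..<n}" "j \<in> {..<n}" "v i = v j"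
    then show "i = j" using mv[of i i] mv[of j i] by (auto split: if_splits)
  qed
  have "independent (v ` {..<n})"
  proof (rule independent_if_scalars_zero)
    fix f w assume f: "(\<Sum>w\<in>v ` {..<n}. f w *\<^sub>R w) = 0" and "w \<in> v ` {..<n}"
    then obtain k where k: "k < n" "w = v k" by blast
    have "0 = m k \<bullet> (\<Sum>j<n. f (v j) *\<^sub>R v j)"
      using f by (simp add: sum.reindex[OF inj])
    also have "\<dots> = (\<Sum>j<n. if j = k then f (v j) else 0)"
      unfolding inner_sum_right using mv by (intro sum.cong) auto
    also have "\<dots> = f w" using k by simp
    finally show "f w = 0" by simp
  qed simp
  \<comment> \<open>The \<open>n\<close> independent vectors lie in \<open>W\<close>, so this bound
    makes them span it. It comes from affine dimension at most \<open>n - 1\<close>, raised by one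
    through homogenization.\<close>
  moreover have "dim W \<le> card (v ` {..<n})"
  proof -
    have "int (dim W) = int (dim ((\<lambda>x. (x, 1 :: real)) ` (p ` edges n)))"
      unfolding W_def dim_span H_def by (simp add: image_image)
    also have "\<dots> \<le> aff_dim (p ` edges n) + 1" by (rule dim_homogenization_le)
    also have "\<dots> \<le> int n" using aff_dim_clique_or_star[OF n fac] by simp
    finally show ?thesis by (simp add: card_image[OF inj])
  qed
  ultimately have "W \<subseteq> span (v ` {..<n})"
    using vW by (intro card_ge_dim_independent) auto
  moreover have exp: "w = (\<Sum>k<n. (m k \<bullet> w) *\<^sub>R v k)" if "w \<in> span (v ` {..<n})" for w
  proof (rule linear_eq_on_span[OF _ _ _ that])
    show "linear (\<lambda>w. w)" by (rule linear_ident)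
    show "linear (\<lambda>w. \<Sum>k<n. (m k \<bullet> w) *\<^sub>R v k)"
      by (rule linearI) (auto simp: inner_simps sum.distrib scaleR_left_distrib scaleR_right.sum)
    show "w = (\<Sum>k<n. (m k \<bullet> w) *\<^sub>R v k)" if w: "w \<in> v ` {..<n}" for w
    proof -
      obtain j where j: "j < n" "w = v j" using w by blast
      have "(\<Sum>k<n. (m k \<bullet> v j) *\<^sub>R v k) = (\<Sum>k<n. if k = j then v k else 0)"
        using mv[OF j(1)] by (intro sum.cong) auto
      then show ?thesis using j by simp
    qed
  qed
  ultimately have rep: "H e = (\<Sum>i\<in>e. a e i *\<^sub>R v i)" if e: "e \<in> edges n" for e
  proof -
    have "H e \<in> span (v ` {..<n})"
      using \<open>W \<subseteq> _\<close> e unfolding W_def by (blast intro: span_base)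
    then have "H e = (\<Sum>k<n. a e k *\<^sub>R v k)" unfolding a_def by (rule exp)
    also have "\<dots> = (\<Sum>i\<in>e. a e i *\<^sub>R v i)"
      using e zero[OF e] by (intro sum.mono_neutral_right) (auto simp: edges_def)
    finally show ?thesis .
  qed
  show thesis
  proof (rule that)
    show "\<exists>g. linear g \<and> (\<forall>i<n. g (v i) = h i)" for h :: "nat \<Rightarrow> real"
    proof (intro exI conjI allI impI)
      show "linear (\<lambda>w. \<Sum>k<n. h k * (m k \<bullet> w))"
        by (rule linearI) (auto simp: inner_simps sum.distrib algebra_simps sum_distrib_left)
      show "(\<Sum>k<n. h k * (m k \<bullet> v i)) = h i" if "i < n" for i
      proof -
        have "(\<Sum>k<n. h k * (m k \<bullet> v i)) = (\<Sum>k<n. if k = i then h k else 0)"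
          using mv[OF that] by (intro sum.cong) auto
        then show ?thesis using that by simp
      qed
    qed
  qed (use rep pos H_def in auto)
qed

section \<open>Adjoining one index to a combinatorial second hypersimplex\<close>

theorem corollary5p4:
  fixes n :: nat and P :: "'a::euclidean_space set"
  assumes "n \<ge> 3"
    and "combinatorial_hypersimplex n 2 P"
  shows "\<exists>(Q :: ('a \<times> real) set) F.
           combinatorial_hypersimplex (n + 1) 2 Q \<and> F facet_of Q \<and> affinely_isomorphic P F"
proof -
  have "polytope P" and "face_lattice_isomorphic P (convex hull (edge_vertex ` edges n))"
    using assms(2) by (auto simp: combinatorial_hypersimplex_def hypersimplex_2_eq)
  from face_lattice_isomorphicE[OF finite_edges this edge_vertex_face]
  obtain p where P: "P = convex hull (p ` edges n)"
    and p: "\<And>S. facial edge_vertex (edges n) S \<Longrightarrow> facial p (edges n) S"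
      "\<And>S. facial p (edges n) S \<Longrightarrow> facial edge_vertex (edges n) S"
    by blast
  have fac: "facial p (edges n) S \<longleftrightarrow> clique_or_star n S" for S
    using p facial_edge_vertex_iff[of n S] by auto
  obtain a and v :: "nat \<Rightarrow> 'a \<times> real"
    where rep: "\<And>e. e \<in> edges n \<Longrightarrow> (p e, 1) = (\<Sum>i\<in>e. a e i *\<^sub>R v i)"
      and pos: "\<And>e i. e \<in> edges n \<Longrightarrow> i \<in> e \<Longrightarrow> a e i > 0"
      and dual: "\<And>h :: nat \<Rightarrow> real. \<exists>g. linear g \<and> (\<forall>i<n. g (v i) = h i)"
    by (rule edge_coordinates[OF assms(1) fac]) blast
  \<comment> \<open>The sum bounds every \<open>\<bar>snd (v i)\<bar>\<close>, and the added 1 makes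
    \<open>t * \<bar>snd (v i)\<bar>\<close> strictly less than 1, so
    \<open>t * snd (v i) + 1\<close> is positive even when \<open>snd (v i)\<close> is
    negative.\<close>
  define t where "t = 1 / (1 + (\<Sum>i<n. \<bar>snd (v i)\<bar>))"
  have norm_pos: "1 + (\<Sum>i<n. \<bar>snd (v i)\<bar>) > 0" by (simp add: sum_nonneg add_pos_nonneg)
  then have "t > 0" unfolding t_def by simp
  have t: "t * snd (v i) + 1 > 0" if "i < n" for i
  proof -
    have "\<bar>snd (v i)\<bar> \<le> (\<Sum>i<n. \<bar>snd (v i)\<bar>)"
      using that by (intro member_le_sum) auto
    then have "- snd (v i) < 1 + (\<Sum>i<n. \<bar>snd (v i)\<bar>)" by linarith
    then have "t * - snd (v i) < 1" 
      unfolding t_def using norm_pos by (simp add: field_simps)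
    then show ?thesis by simp
  qed
  \<comment> \<open>Vectors are written \<open>((x, s), height)\<close>: the old ones have new
    coordinate \<open>s = 0\<close>, and the added one sits at \<open>s = 1\<close> with height
    1.\<close>
  define u :: "nat \<Rightarrow> ('a \<times> real) \<times> real"
    where "u i = (if i < n then ((fst (v i), 0), snd (v i)) else ((0, 1), 1))" for i
  \<comment> \<open>Old edges keep their coefficients; a new edge \<open>{i, n}\<close> gets the
    direction \<open>t *\<^sub>R u i + u n\<close>.\<close>
  define b where "b e i = (if n \<notin> e then a e i else if i = n then 1 else t)" for e i
  define z where "z e = (\<Sum>i\<in>e. b e i *\<^sub>R u i)" for e
  define q where "q e = (1 / snd (z e)) *\<^sub>R fst (z e)" for e
  let ?E = "edges (n + 1)"
  have sub: "edges n \<subseteq> ?E" by (auto simp: edges_def)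
  have clique: "edges n = {e \<in> ?E. e \<subseteq> {..<n}}" by (auto simp: edges_def)
  \<comment> \<open>Old edges already have height 1, so \<open>q e = (p e, 0)\<close> and their
    points span a copy of \<open>P\<close>.\<close>
  have zn: "z e = ((p e, 0), 1)" if e: "e \<in> edges n" for e
  proof -
    have "i < n" if "i \<in> e" for i using e that by (auto simp: edges_def)
    then have "z e = (\<Sum>i\<in>e. a e i *\<^sub>R ((fst (v i), 0), snd (v i)))"
      unfolding z_def b_def u_def by (intro sum.cong) auto
    also have "\<dots> = ((fst (\<Sum>i\<in>e. a e i *\<^sub>R v i), 0), snd (\<Sum>i\<in>e. a e i *\<^sub>R v i))"
      by (simp add: prod_eq_iff fst_sum snd_sum)
    finally show ?thesis unfolding rep[OF e, symmetric] by simp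
  qed
  have new: "\<exists>i<n. e = {i, n}" if "e \<in> ?E" "e \<notin> edges n" for e
  proof -
    have "n \<in> e" using that by (auto simp: edges_def less_Suc_eq)
    with that(1) obtain j where "e = {n, j}" "n \<noteq> j" "j < n + 1" by (rule edge_other)
    then show ?thesis by (intro exI[of _ j]) auto
  qed
  have bpos: "b e i > 0" if "e \<in> ?E" "i \<in> e" for e i
    using that pos[of e i] \<open>t > 0\<close> clique new[of e] by (auto simp: b_def edges_def)
  have zpos: "snd (z e) > 0" if e: "e \<in> ?E" for e
  proof (cases "e \<in> edges n")
    case False
    then obtain i where i: "i < n" "e = {i, n}" using new e by blast
    then have "snd (z e) = t * snd (v i) + 1"
      by (simp add: z_def b_def u_def)
    then show ?thesis using t i by simp
  qed (simp add: zn)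
  have qrep: "(q e, 1) = (\<Sum>i\<in>e. (b e i / snd (z e)) *\<^sub>R u i)" if "e \<in> ?E" for e
  proof -
    have "(\<Sum>i\<in>e. (b e i / snd (z e)) *\<^sub>R u i) = (1 / snd (z e)) *\<^sub>R z e"
      unfolding z_def scaleR_right.sum by (intro sum.cong) auto
    then show ?thesis using zpos[OF that] by (simp add: q_def prod_eq_iff)
  qed
  have qpos: "b e i / snd (z e) > 0" if "e \<in> ?E" "i \<in> e" for e i
    using bpos zpos that by simp
  have qdual: "\<exists>g. linear g \<and> (\<forall>i<n+1. g (u i) = h i)" for h :: "nat \<Rightarrow> real"
  proof -
    obtain g where g: "linear g" "\<forall>i<n. g (v i) = h i" using dual by blast
    interpret linear g by fact
    \<comment> \<open>The old functional sees the new vector through its height, as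
      \<open>g (0, 1)\<close>; the coefficient of the new coordinate corrects the value there to
      \<open>h n\<close>.\<close>
    let ?g = "\<lambda>x :: ('a \<times> real) \<times> real.
      g (fst (fst x), snd x) + snd (fst x) * (h n - g (0, 1))"
    have "linear ?g"
    proof (rule linearI)
      fix x y :: "('a \<times> real) \<times> real" and r
      show "?g (x + y) = ?g x + ?g y"
        using add[of "(fst (fst x), snd x)" "(fst (fst y), snd y)"] by (simp add: algebra_simps)
      show "?g (r *\<^sub>R x) = r *\<^sub>R ?g x"
        using scale[of r "(fst (fst x), snd x)"] by (simp add: algebra_simps)
    qed
    moreover have "?g (u i) = h i" if "i < n + 1" for i
      using that g(2) by (auto simp: u_def less_Suc_eq)
    ultimately show ?thesis by blast
  qed
  have qfac: "facial q ?E S \<longleftrightarrow> clique_or_star (n + 1) S" for S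
    using facial_imp_clique_or_star[OF qrep qpos] clique_or_star_imp_facial[OF qrep qpos qdual] by blast
  define Q where "Q = convex hull (q ` ?E)"
  define F where "F = convex hull (q ` edges n)"
  have "facial q ?E S \<longleftrightarrow> facial edge_vertex ?E S" for S
    by (simp only: qfac) (simp add: facial_edge_vertex_iff)
  then have "face_lattice_isomorphic Q (hypersimplex (n + 1) 2)"
    unfolding Q_def hypersimplex_2_eq by (intro face_lattice_isomorphicI) auto
  then have "combinatorial_hypersimplex (n + 1) 2 Q"
    using assms(1) by (simp add: combinatorial_hypersimplex_def Q_def polytope_convex_hull)
  moreover have "F facet_of Q"
    unfolding F_def Q_def
  proof (rule maximal_facial_facet)
    show "facial q ?E (edges n)"
      unfolding qfac by (subst clique) (rule clique_or_starI_clique)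
    show "edges n \<noteq> {}" using edge_doubleton[of 0 n 1] assms(1) by auto
    have "{0, n} \<in> ?E" "{0, n} \<notin> edges n"
      using edge_doubleton[of 0 "n + 1" n] assms(1) by (simp, simp add: edges_def)
    then show "edges n \<noteq> ?E" by blast
  qed (use clique_or_star_maximal_clique[OF assms(1)] qfac in auto)
  moreover have "affinely_isomorphic P F"
    unfolding affinely_isomorphic_def
  proof (intro exI conjI)
    let ?f = "\<lambda>x :: 'a. (x, 0 :: real)"
    show lin: "linear ?f" by (rule linearI) auto
    show "inj_on (\<lambda>x. 0 + ?f x) (affine hull P)" by (auto simp: inj_on_def)
    have "?f ` p ` edges n = q ` edges n"
      by (auto simp: q_def zn image_image)
    then show "(\<lambda>x. 0 + ?f x) ` P = F"
      unfolding P F_def using convex_hull_linear_image[OF lin, of "p ` edges n"] by simp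
  qed
  ultimately show ?thesis by blast
qed

end
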